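(* For all integers $n\ge 0$, the $q$-Chebyshev polynomials satisfy the $q$-differential equations $$(x^2+qs)\,D^2T_n(x,q^2s,q)+q^{n-1}x\,D\,T_n(x,s,q)=[n]^2\,T_n(x,s,q)$$ and $$(x^2+qs)\,D^2U_n(x,q^2s,q)+q^{n-1}[3]\,x\,D\,U_n(x,s,q)=[n][n+2]\,U_n(x,s,q).$$
   Context: Here $x,s,q$ are indeterminates. $D$ is the $q$-differentiation operator with respect to $x$, $Df(x)=\frac{f(x)-f(qx)}{x-qx}$; e.g. $D^2T_n(x,q^2s,q)$ means $D^2$ applied to the polynomial $x\mapsto T_n(x,q^2s,q)$. Notation: $(a;q)_n=\prod_{j=0}^{n-1}(1-q^ja)$; $\begin{bmatrix} n\\k\end{bmatrix}=\frac{(q;q)_n}{(q;q)_k(q;q)_{n-k}}$ for $0\le k\le n$; $[n]=\frac{1-q^n}{1-q}$. The $q$-Chebyshev polynomials of the second kind are, for $n\ge0$, $$U_n(x,s,q)=\sum_{k=0}^{\lfloor n/2\rfloor}q^{k^2}\begin{bmatrix} n-k\\k\end{bmatrix}(1+q^{k+1})\cdots(1+q^{n-k})\,s^kx^{n-2k}.$$ The $q$-Chebyshev polynomials of the first kind are $T_0(x,s,q)=1$ and, for $n>0$, $$T_n(x,s,q)=\sum_{k=0}^{\lfloor n/2\rfloor}q^{k^2}\frac{[n]}{[n-k]}\begin{bmatrix} n-k\\k\end{bmatrix}\frac{(-q;q)_{n-1}}{(-q;q)_k\,(-q^{n-k};q)_k}\,s^kx^{n-2k}.$$ *)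

theory Defs
  imports
    "HOL-Computational_Algebra.Polynomial"
    "HOL-Computational_Algebra.Fraction_Field"
begin

text \<open>
  The indeterminates \<open>q\<close> and \<open>s\<close> generate the field of rational functions \<open>K(q, s)\<close> over an
  arbitrary field \<open>K\<close>, realised as the fraction field of \<open>K[q][s]\<close>.  The indeterminate \<open>x\<close> is
  the variable of the univariate polynomials over that field.
\<close>

definition indet_q :: "'k::field poly poly fract"
  where "indet_q = Fract [:[:0, 1:]:] 1"

definition indet_s :: "'k::field poly poly fract"
  where "indet_s = Fract [:0, 1:] 1"

definition qpoch :: "'a::field \<Rightarrow> 'a \<Rightarrow> nat \<Rightarrow> 'a"
  where "qpoch a q n = (\<Prod>j<n. 1 - q ^ j * a)"

definition qnum :: "'a::field \<Rightarrow> nat \<Rightarrow> 'a"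
  where "qnum q n = (1 - q ^ n) / (1 - q)"

text \<open>Only meaningful (and only used) for \<open>k \<le> n\<close>, as the subtraction truncates.\<close>

definition qbinom :: "'a::field \<Rightarrow> nat \<Rightarrow> nat \<Rightarrow> 'a"
  where "qbinom q n k = qpoch q q n / (qpoch q q k * qpoch q q (n - k))"

text \<open>\<open>(f(x) - f(q x)) / (x - q x)\<close> on polynomials in \<open>x\<close>; by \<open>qdiff_exact\<close> the division is
  exact.\<close>

definition qdiff :: "'a::field \<Rightarrow> 'a poly \<Rightarrow> 'a poly"
  where "qdiff q f = (f - f \<circ>\<^sub>p [:0, q:]) div [:0, 1 - q:]"

lemma qdiff_exact:
  assumes "q \<noteq> 1"
  shows "qdiff q f * [:0, 1 - q:] = f - f \<circ>\<^sub>p [:0, q:]"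
proof -
  have "poly (f - f \<circ>\<^sub>p [:0, q:]) 0 = 0"
    by (simp add: poly_pcompose)
  then have "[:0, 1:] dvd f - f \<circ>\<^sub>p [:0, q:]"
    unfolding poly_eq_0_iff_dvd by simp
  then obtain g where g: "f - f \<circ>\<^sub>p [:0, q:] = [:0, 1:] * g"
    by (rule dvdE)
  have "f - f \<circ>\<^sub>p [:0, q:] = [:0, 1 - q:] * smult (inverse (1 - q)) g"
    using assms by (simp add: g)
  then have "[:0, 1 - q:] dvd f - f \<circ>\<^sub>p [:0, q:]"
    by (rule dvdI)
  then show ?thesis
    unfolding qdiff_def by (rule dvd_div_mult_self)
qed

lemma indet_q_neq_1: "indet_q \<noteq> (1 :: 'k::field poly poly fract)"
  by (simp add: indet_q_def One_fract_def eq_fract one_pCons)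

text \<open>The polynomial variable is \<open>x\<close>; the empty product for \<open>n - k < k + 1\<close> is \<open>1\<close>.\<close>

definition qcheb_U :: "nat \<Rightarrow> 'a::field \<Rightarrow> 'a \<Rightarrow> 'a poly"
  where "qcheb_U n s q =
    (\<Sum>k = 0..n div 2.
      monom (q ^ (k\<^sup>2) * qbinom q (n - k) k * (\<Prod>j = k + 1..n - k. 1 + q ^ j) * s ^ k)
        (n - 2 * k))"

definition qcheb_T :: "nat \<Rightarrow> 'a::field \<Rightarrow> 'a \<Rightarrow> 'a poly"
  where "qcheb_T n s q =
    (if n = 0 then 1
     else \<Sum>k = 0..n div 2.
      monom (q ^ (k\<^sup>2) * (qnum q n / qnum q (n - k)) * qbinom q (n - k) k *
             (qpoch (- q) q (n - 1) / (qpoch (- q) q k * qpoch (- (q ^ (n - k))) q k)) * s ^ k)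
        (n - 2 * k))"

end

theory Submission
  imports Defs
begin

text \<open>
  Both families have the shape \<open>P(s) = (\<Sum>k. c\<^sub>k s^k x^(n - 2k))\<close>.  Since \<open>D x^m = [m] x^(m - 1)\<close>, the
  operators \<open>x\<^sup>2 D\<^sup>2\<close> and \<open>x D\<close> act diagonally on monomials, while \<open>q s D\<^sup>2\<close> carries the monomial of
  index \<open>k\<close> to that of index \<open>k + 1\<close>.  Replacing \<open>s\<close> by \<open>q\<^sup>2 s\<close> under \<open>D\<^sup>2\<close> only inserts the factor
  \<open>q^(2k)\<close>.  Hence the equation with eigenvalue \<open>\<lambda>\<close> and coefficient \<open>\<mu>\<close> of \<open>x D\<close> amounts to a two-term
  recurrence for the coefficients (\<open>qdiff_equation_of_recurrence\<close>):
  \<open>(\<lambda> - q^(2k + 2) [a][a - 1] - \<mu> [a]) c\<^sub>k\<^sub>+\<^sub>1 = q^(2k + 1) [a + 2][a + 1] c\<^sub>k\<close>, where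
  \<open>a = n - 2k - 2\<close>.

  What makes the specific \<open>\<lambda>\<close> and \<open>\<mu>\<close> work is that the bracket on the left factors: up to
  \<open>(1 - q)\<^sup>2\<close> it is \<open>(1 - q^(2k + 2)) (1 - q^(2(n - k - 1)))\<close> for the first kind and
  \<open>(1 - q^(2k + 2)) (1 - q^(2(n - k)))\<close> for the second (\<open>qnum_eigenvalue_T\<close>, \<open>qnum_eigenvalue_U\<close>).
  Writing each \<open>1 - q^(2m)\<close> as \<open>(1 - q^m) (1 + q^m)\<close>, the factors \<open>1 - q^m\<close> form the denominator of
  the ratio of consecutive \<open>q\<close>-binomials (times \<open>[n] / [n - k]\<close> for the first kind), and the factors
  \<open>1 + q^m\<close> form that of the ratio of consecutive \<open>(-q; q)\<close>-products (\<open>qcheb_T_coeff_step\<close>,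
  \<open>qcheb_U_coeff_step\<close>).

  The argument works in any field in which \<open>q\<close> is not a root of unity; this makes all denominators
  nonzero, and it holds for the indeterminate \<open>q\<close>.
\<close>

section \<open>The \<open>q\<close>-derivative on polynomials\<close>

text \<open>Multiplying back by \<open>x - q x\<close> removes the polynomial division from the definition of
  \<^const>\<open>qdiff\<close>; every computation with it goes through this rule.\<close>

lemma qdiff_eqI:
  assumes "q \<noteq> 1" and "g * [:0, 1 - q:] = f - f \<circ>\<^sub>p [:0, q:]"
  shows "qdiff q f = g"
proof -
  have "qdiff q f * [:0, 1 - q:] = g * [:0, 1 - q:]"
    unfolding qdiff_exact[OF assms(1)] assms(2) ..
  then show ?thesis
    using assms(1) by (subst (asm) mult_right_cancel) simp_all
qed

lemma qdiff_0: "q \<noteq> 1 \<Longrightarrow> qdiff q 0 = 0"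
  by (rule qdiff_eqI) auto

lemma qdiff_add:
  assumes "q \<noteq> 1"
  shows "qdiff q (f + g) = qdiff q f + qdiff q g"
  by (rule qdiff_eqI[OF assms])
    (simp only: distrib_right qdiff_exact[OF assms] pcompose_add add_diff_add)

lemma qdiff_sum: "q \<noteq> 1 \<Longrightarrow> qdiff q (\<Sum>i\<in>A. f i) = (\<Sum>i\<in>A. qdiff q (f i))"
  by (induction A rule: infinite_finite_induct) (simp_all add: qdiff_0 qdiff_add)

lemma qnum_0 [simp]: "qnum q 0 = 0"
  by (simp add: qnum_def)

lemma pcompose_monom_scale: "monom c m \<circ>\<^sub>p [:0, q:] = monom (c * q ^ m) m"
  for c :: "'a::comm_semiring_1"
  by (induction m) (simp_all add: monom_0 monom_Suc pcompose_pCons smult_monom ac_simps)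

lemma qdiff_monom:
  assumes "q \<noteq> 1"
  shows "qdiff q (monom c m) = monom (c * qnum q m) (m - 1)"
proof (rule qdiff_eqI[OF assms])
  have x: "[:0, 1 - q:] = monom (1 - q) 1"
    by (simp add: monom_Suc monom_0)
  show "monom (c * qnum q m) (m - 1) * [:0, 1 - q:] = monom c m - monom c m \<circ>\<^sub>p [:0, q:]"
    using assms unfolding x pcompose_monom_scale mult_monom diff_monom
    by (cases m) (simp_all add: qnum_def divide_simps, simp add: algebra_simps)
qed

section \<open>The differential equation as a two-term recurrence\<close>

lemma smult_sum_right: "smult c (\<Sum>i\<in>A. f i) = (\<Sum>i\<in>A. smult c (f i))"
  by (induction A rule: infinite_finite_induct) (simp_all add: smult_add_right)

text \<open>The coefficient comparison.  The condition \<open>init\<close> is the comparison at \<open>x^n\<close>, which \<open>q s D\<^sup>2\<close>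
  does not reach; \<open>rec\<close> is the comparison at \<open>x^a\<close> for each \<open>a = n - 2 (k + 1)\<close>.  The last summand, of
  degree 0 or 1, is annihilated by \<open>D\<^sup>2\<close>, so no condition arises beyond the end of the sum.\<close>

lemma qdiff_equation_of_recurrence:
  fixes q s lam mu :: "'a::field" and c :: "nat \<Rightarrow> 'a" and n :: nat
  defines "P \<equiv> \<lambda>t. \<Sum>k = 0..n div 2. monom (c k * t ^ k) (n - 2 * k)"
  assumes q: "q \<noteq> 1"
    and init: "lam = qnum q n * qnum q (n - 1) + mu * qnum q n"
    and rec: "\<And>a k. n = a + 2 * Suc k \<Longrightarrow>
      (lam - q ^ (2 * Suc k) * (qnum q a * qnum q (a - 1)) - mu * qnum q a) * c (Suc k)
        = q ^ (2 * k + 1) * (qnum q (a + 2) * qnum q (a + 1)) * c k"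
  shows "([:0, 1:]\<^sup>2 + [:q * s:]) * qdiff q (qdiff q (P (q\<^sup>2 * s)))
           + smult mu ([:0, 1:] * qdiff q (P s)) = smult lam (P s)"
proof -
  define N where "N = n div 2"
  define B where "B k = c k * s ^ k" for k
  define b where "b k = q ^ (2 * k) * (qnum q (n - 2 * k) * qnum q (n - 2 * k - 1))" for k
  \<comment> \<open>\<open>A\<close> collects the diagonal contributions, \<open>C\<close> those of \<open>q s D\<^sup>2\<close>; the claim is \<open>\<Sum>A = \<Sum>C\<close>.\<close>
  define A where "A k = monom ((lam - b k - mu * qnum q (n - 2 * k)) * B k) (n - 2 * k)" for k
  define C where "C k = monom (q * s * (b k * B k)) (n - 2 * k - 2)" for k
  have X: "[:0, 1:] = monom 1 1" and X2: "[:0, 1:]\<^sup>2 = monom 1 2"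
    and S: "[:q * s:] = monom (q * s) 0"
    by (simp_all add: monom_Suc monom_0 power2_eq_square numeral_2_eq_2)
  have D1: "[:0, 1:] * qdiff q (P s) =
      (\<Sum>k = 0..N. monom (qnum q (n - 2 * k) * B k) (n - 2 * k))"
  proof -
    have "monom 1 1 * monom (c k * s ^ k * qnum q (n - 2 * k)) (n - 2 * k - 1)
        = monom (qnum q (n - 2 * k) * B k) (n - 2 * k)" for k
      by (cases "n - 2 * k") (simp_all add: mult_monom B_def ac_simps)
    then show ?thesis
      unfolding X P_def N_def qdiff_sum[OF q] qdiff_monom[OF q] sum_distrib_left by simp
  qed
  have D2: "qdiff q (qdiff q (P (q\<^sup>2 * s))) = (\<Sum>k = 0..N. monom (b k * B k) (n - 2 * k - 2))"
  proof -
    have "c k * (q\<^sup>2 * s) ^ k * qnum q (n - 2 * k) * qnum q (n - 2 * k - 1) = b k * B k" for k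
      by (simp add: b_def B_def power_mult_distrib power_mult[symmetric] ac_simps)
    then show ?thesis
      unfolding P_def N_def qdiff_sum[OF q] qdiff_monom[OF q] by (simp add: numeral_2_eq_2)
  qed
  have "monom 1 2 * monom (b k * B k) (n - 2 * k - 2) = monom (b k * B k) (n - 2 * k)" for k
  proof -
    \<comment> \<open>For exponents 0 and 1 \<open>n - 2 * k - 2\<close> truncates, but the coefficient vanishes.\<close>
    consider "n - 2 * k = 0" | "n - 2 * k = 1" | a where "n - 2 * k = Suc (Suc a)"
      by (metis One_nat_def not0_implies_Suc)
    then show ?thesis
      by cases (simp_all add: b_def mult_monom numeral_2_eq_2)
  qed
  then have D2x: "[:0, 1:]\<^sup>2 * qdiff q (qdiff q (P (q\<^sup>2 * s)))
      = (\<Sum>k = 0..N. monom (b k * B k) (n - 2 * k))"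
    unfolding D2 X2 sum_distrib_left by simp
  have D2s: "[:q * s:] * qdiff q (qdiff q (P (q\<^sup>2 * s))) = sum C {0..N}"
    unfolding D2 S sum_distrib_left C_def by (simp add: mult_monom)
  have A0: "A 0 = 0"
    by (simp add: A_def b_def init algebra_simps)
  have "n - 2 * N = 0 \<or> n - 2 * N = 1"
    unfolding N_def by presburger
  then have CN: "C N = 0"
    by (auto simp: C_def b_def)
  have CA: "C k = A (Suc k)" if "k < N" for k
  proof -
    define a where "a = n - 2 * Suc k"
    have n: "n = a + 2 * Suc k"
      using that by (simp add: a_def N_def)
    have "(lam - b (Suc k) - mu * qnum q (n - 2 * Suc k)) * B (Suc k)
        = s ^ Suc k * ((lam - q ^ (2 * Suc k) * (qnum q a * qnum q (a - 1)) - mu * qnum q a)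
            * c (Suc k))"
      unfolding b_def B_def a_def by (simp only: ac_simps)
    also have "\<dots> = q * s * (b k * B k)"
      unfolding rec[OF n] by (simp add: b_def B_def n)
    finally show ?thesis
      unfolding C_def A_def by simp
  qed
  have P_eq: "P s = (\<Sum>k = 0..N. monom (B k) (n - 2 * k))"
    unfolding P_def N_def B_def ..
  have "sum C {0..N} = sum C {..<N}"
    using CN by (simp add: atLeast0AtMost lessThan_Suc_atMost[symmetric])
  also have "\<dots> = (\<Sum>k<N. A (Suc k))"
    using CA by simp
  also have "\<dots> = sum A {0..N}"
    using A0 by (simp add: sum.lessThan_Suc_shift atLeast0AtMost lessThan_Suc_atMost[symmetric]
        del: sum.lessThan_Suc)
  also have "\<dots> = smult lam (P s) - [:0, 1:]\<^sup>2 * qdiff q (qdiff q (P (q\<^sup>2 * s)))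
      - smult mu ([:0, 1:] * qdiff q (P s))"
    unfolding D1 D2x unfolding P_eq A_def
    by (simp add: smult_sum_right sum_subtractf[symmetric] smult_monom diff_monom left_diff_distrib
        mult.assoc)
  finally show ?thesis
    using D2s by (simp add: distrib_right algebra_simps)
qed

section \<open>The eigenvalue identities\<close>

text \<open>In terms of \<open>K = q^(k + 1)\<close> and \<open>Q = q^n\<close> the numerator on the left is
  \<open>(1 - Q)\<^sup>2 - (K\<^sup>2 - Q)(1 - Q/(K\<^sup>2 q)) - (Q/q)(1 - Q/K\<^sup>2)(1 - q)\<close>, in which everything cancels except
  \<open>1 - K\<^sup>2 - Q\<^sup>2/K\<^sup>2 + Q\<^sup>2 = (1 - K\<^sup>2)(1 - Q\<^sup>2/K\<^sup>2)\<close>.  Setting \<open>Q = K\<^sup>2 M q\<close> with \<open>M = q^(a - 1)\<close> avoids the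
  divisions; the case \<open>a = 0\<close> is separate because there \<open>a - 1\<close> truncates.\<close>

lemma qnum_eigenvalue_T:
  fixes q :: "'a::field"
  assumes "q \<noteq> 1" and "n = a + 2 * Suc k"
  shows "(qnum q n)\<^sup>2 - q ^ (2 * Suc k) * (qnum q a * qnum q (a - 1)) - q ^ (n - 1) * qnum q a
    = (1 - q ^ (2 * Suc k)) * (1 - q ^ (2 * (a + Suc k))) / (1 - q)\<^sup>2"
proof (cases a)
  case 0
  then show ?thesis
    using assms by (simp add: qnum_def power2_eq_square)
next
  case (Suc b)
  define K M where "K = q ^ Suc k" and "M = q ^ b"
  have e: "q ^ n = K\<^sup>2 * M * q" "q ^ (2 * Suc k) = K\<^sup>2" "q ^ (n - 1) = K\<^sup>2 * M"
    "q ^ (2 * (a + Suc k)) = (q * M * K)\<^sup>2" "q ^ a = q * M" "q ^ (a - 1) = M"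
    unfolding K_def M_def assms(2) Suc
    by (simp_all add: power_add power_mult power2_eq_square power_mult_distrib ac_simps)
  have "((1 - K\<^sup>2 * M * q) / (1 - q))\<^sup>2 - K\<^sup>2 * (((1 - q * M) / (1 - q)) * ((1 - M) / (1 - q)))
      - K\<^sup>2 * M * ((1 - q * M) / (1 - q)) = (1 - K\<^sup>2) * (1 - (q * M * K)\<^sup>2) / (1 - q)\<^sup>2"
    using assms(1) by (simp add: divide_simps) (simp add: power2_eq_square algebra_simps)
  then show ?thesis
    unfolding qnum_def e .
qed

text \<open>The same cancellation, with \<open>Q q\<close> in place of \<open>Q\<close> in the result:
  \<open>(1 - K\<^sup>2)(1 - Q\<^sup>2 q\<^sup>2/K\<^sup>2)\<close>.\<close>

lemma qnum_eigenvalue_U: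
  fixes q :: "'a::field"
  assumes "q \<noteq> 1" and "n = a + 2 * Suc k"
  shows "qnum q n * qnum q (n + 2) - q ^ (2 * Suc k) * (qnum q a * qnum q (a - 1))
      - q ^ (n - 1) * qnum q 3 * qnum q a
    = (1 - q ^ (2 * Suc k)) * (1 - q ^ (2 * (a + k + 2))) / (1 - q)\<^sup>2"
proof (cases a)
  case 0
  have "n + 2 = 2 * (a + k + 2)"
    using 0 assms(2) by simp
  then show ?thesis
    using 0 assms by (simp add: qnum_def power2_eq_square)
next
  case (Suc b)
  define K M where "K = q ^ Suc k" and "M = q ^ b"
  have e: "q ^ n = K\<^sup>2 * M * q" "q ^ (n + 2) = K\<^sup>2 * M * q ^ 3"
    "q ^ (2 * Suc k) = K\<^sup>2" "q ^ (n - 1) = K\<^sup>2 * M"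
    "q ^ (2 * (a + k + 2)) = (q\<^sup>2 * M * K)\<^sup>2" "q ^ a = q * M" "q ^ (a - 1) = M"
    unfolding K_def M_def assms(2) Suc
    by (simp_all add: power_add power_mult power2_eq_square power3_eq_cube power_mult_distrib
        ac_simps)
  have "((1 - K\<^sup>2 * M * q) / (1 - q)) * ((1 - K\<^sup>2 * M * q ^ 3) / (1 - q))
      - K\<^sup>2 * (((1 - q * M) / (1 - q)) * ((1 - M) / (1 - q)))
      - K\<^sup>2 * M * ((1 - q ^ 3) / (1 - q)) * ((1 - q * M) / (1 - q))
      = (1 - K\<^sup>2) * (1 - (q\<^sup>2 * M * K)\<^sup>2) / (1 - q)\<^sup>2"
    using assms(1)
    by (simp add: divide_simps) (simp add: eval_nat_numeral algebra_simps)
  then show ?thesis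
    unfolding qnum_def e .
qed

section \<open>The coefficient recurrences\<close>

lemma qpoch_Suc: "qpoch a q (Suc n) = qpoch a q n * (1 - q ^ n * a)"
  by (simp add: qpoch_def)

lemma qpoch_Suc_shift: "qpoch a q (Suc n) = (1 - a) * qpoch (q * a) q n"
  unfolding qpoch_def by (subst prod.lessThan_Suc_shift) (simp add: ac_simps)

lemma qpoch_q_nonzero:
  fixes q :: "'a::field"
  assumes "\<forall>m>0. q ^ m \<noteq> 1"
  shows "qpoch q q n \<noteq> 0"
proof -
  have "1 - q ^ j * q \<noteq> 0" for j
    using assms[rule_format, of "Suc j"] by (simp add: mult.commute)
  then show ?thesis
    by (simp add: qpoch_def)
qed

text \<open>If \<open>q^m = -1\<close> then \<open>q^(2m) = 1\<close>, so denominators built from \<open>1 + q^m\<close> need no hypothesis of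
  their own.\<close>

lemma one_plus_power_nonzero:
  fixes q :: "'a::field"
  assumes "\<forall>m>0. q ^ m \<noteq> 1" and "0 < m"
  shows "1 + q ^ m \<noteq> 0"
proof
  assume "1 + q ^ m = 0"
  then have "q ^ m = - 1"
    by (simp add: add_eq_0_iff)
  then have "q ^ (m * 2) = 1"
    by (simp add: power_mult)
  then show False
    using assms by simp
qed

lemma qpoch_minus_nonzero:
  fixes q :: "'a::field"
  assumes "\<forall>m>0. q ^ m \<noteq> 1" and "0 < m"
  shows "qpoch (- (q ^ m)) q n \<noteq> 0"
  using one_plus_power_nonzero[OF assms(1), of "_ + m"] assms(2)
  by (simp add: qpoch_def power_add)

text \<open>The two \<open>q\<close>-binomials are \<open>[n - k - 1 over k + 1]\<close> and \<open>[n - k over k]\<close> for \<open>n = a + 2 (k + 1)\<close>, as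
  they occur in consecutive coefficients of either Chebyshev polynomial.\<close>

lemma qbinom_step:
  fixes q :: "'a::field"
  assumes "\<forall>m>0. q ^ m \<noteq> 1"
  shows "qbinom q (a + k + 1) (Suc k) * ((1 - q ^ (a + k + 2)) * (1 - q ^ Suc k))
    = (1 - q ^ (a + 2)) * (1 - q ^ (a + 1)) * qbinom q (a + k + 2) k"
proof -
  have P: "qpoch q q (Suc m) = qpoch q q m * (1 - q ^ Suc m)" for m
    by (simp add: qpoch_Suc mult.commute)
  have nz: "qpoch q q m \<noteq> 0" "1 - q ^ Suc m \<noteq> 0" for m
    using qpoch_q_nonzero[OF assms] assms[rule_format, of "Suc m"] by auto
  have "a + k + 2 = Suc (a + k + 1)" "a + 2 = Suc (Suc a)" "a + 1 = Suc a"
    "a + k + 1 - Suc k = a" "a + k + 2 - k = Suc (Suc a)"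
    by auto
  note e = this
  show ?thesis
    unfolding qbinom_def e(4,5) unfolding e(1-3) P
    using nz by (simp add: divide_simps del: power_Suc)
qed

lemma power_Suc_square: "q ^ ((Suc k)\<^sup>2) = q ^ (k\<^sup>2) * q ^ (2 * k + 1)"
  for q :: "'a::monoid_mult"
proof -
  have "(Suc k)\<^sup>2 = k\<^sup>2 + (2 * k + 1)"
    by (simp add: power2_eq_square)
  then show ?thesis
    by (simp only: power_add)
qed

lemma one_minus_power_double: "1 - q ^ (2 * m) = (1 - q ^ m) * (1 + q ^ m)"
  for q :: "'a::comm_ring_1"
  by (simp add: algebra_simps power_mult power2_eq_square)

definition qcheb_U_coeff :: "'a::field \<Rightarrow> nat \<Rightarrow> nat \<Rightarrow> 'a"
  where "qcheb_U_coeff q n k =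
    q ^ (k\<^sup>2) * qbinom q (n - k) k * (\<Prod>j = k + 1..n - k. 1 + q ^ j)"

definition qcheb_T_coeff :: "'a::field \<Rightarrow> nat \<Rightarrow> nat \<Rightarrow> 'a"
  where "qcheb_T_coeff q n k =
    q ^ (k\<^sup>2) * (qnum q n / qnum q (n - k)) * qbinom q (n - k) k *
      (qpoch (- q) q (n - 1) / (qpoch (- q) q k * qpoch (- (q ^ (n - k))) q k))"

text \<open>Passing from \<open>k\<close> to \<open>k + 1\<close> shortens the product of the \<open>1 + q^j\<close> at both ends, losing
  \<open>1 + q^(k + 1)\<close> and \<open>1 + q^(n - k)\<close>; these complete the factors \<open>1 - q^m\<close> on the left of
  \<open>qbinom_step\<close> to \<open>1 - q^(2m)\<close>.\<close>

lemma qcheb_U_coeff_step: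
  fixes q :: "'a::field"
  assumes nz: "\<forall>m>0. q ^ m \<noteq> 1" and n: "n = a + 2 * Suc k"
  shows "(1 - q ^ (2 * Suc k)) * (1 - q ^ (2 * (a + k + 2))) * qcheb_U_coeff q n (Suc k)
    = q ^ (2 * k + 1) * ((1 - q ^ (a + 2)) * (1 - q ^ (a + 1))) * qcheb_U_coeff q n k"
proof -
  define R where "R = (\<Prod>j = k + 2..a + k + 1. 1 + q ^ j)"
  have R: "(\<Prod>j = k + 1..a + k + 2. 1 + q ^ j) = (1 + q ^ Suc k) * (1 + q ^ (a + k + 2)) * R"
  proof -
    have "{k + 1..a + k + 2} = insert (k + 1) (insert (a + k + 2) {k + 2..a + k + 1})"
      by auto
    then show ?thesis
      by (simp add: R_def mult.assoc)
  qed
  have e: "n - Suc k = a + k + 1" "n - k = a + k + 2" "Suc k + 1 = k + 2"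
    using n by auto
  have c: "qcheb_U_coeff q n (Suc k) = q ^ (k\<^sup>2) * q ^ (2 * k + 1) * qbinom q (a + k + 1) (Suc k) * R"
    "qcheb_U_coeff q n k = q ^ (k\<^sup>2) * qbinom q (a + k + 2) k
      * ((1 + q ^ Suc k) * (1 + q ^ (a + k + 2)) * R)"
    unfolding qcheb_U_coeff_def power_Suc_square e R by (simp_all add: R_def)
  have "(1 - q ^ (2 * Suc k)) * (1 - q ^ (2 * (a + k + 2))) * qcheb_U_coeff q n (Suc k)
    = q ^ (k\<^sup>2) * q ^ (2 * k + 1) * (1 + q ^ Suc k) * (1 + q ^ (a + k + 2)) * R
      * (qbinom q (a + k + 1) (Suc k) * ((1 - q ^ (a + k + 2)) * (1 - q ^ Suc k)))"
    unfolding c one_minus_power_double by (simp only: ac_simps)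
  also have "\<dots> = q ^ (2 * k + 1) * ((1 - q ^ (a + 2)) * (1 - q ^ (a + 1))) * qcheb_U_coeff q n k"
    unfolding c qbinom_step[OF nz] by (simp only: ac_simps)
  finally show ?thesis .
qed

text \<open>Here the denominator \<open>(-q; q)\<^sub>k (-q^(n - k); q)\<^sub>k\<close> gains \<open>1 + q^(k + 1)\<close> at the end of its first and
  \<open>1 + q^(n - k - 1)\<close> at the start of its second product.  The factor \<open>[n] / [n - k]\<close> trades the
  \<open>1 - q^(n - k)\<close> of \<open>qbinom_step\<close> for \<open>1 - q^(n - k - 1)\<close>, which matches the second of these.\<close>

lemma qcheb_T_coeff_step:
  fixes q :: "'a::field"
  assumes nz: "\<forall>m>0. q ^ m \<noteq> 1" and n: "n = a + 2 * Suc k"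
  shows "(1 - q ^ (2 * Suc k)) * (1 - q ^ (2 * (a + Suc k))) * qcheb_T_coeff q n (Suc k)
    = q ^ (2 * k + 1) * ((1 - q ^ (a + 2)) * (1 - q ^ (a + 1))) * qcheb_T_coeff q n k"
proof -
  define R where "R = qpoch (- (q ^ (a + k + 2))) q k"
  define S where "S = qpoch (- q) q k"
  define Z where "Z = q ^ (k\<^sup>2) * (1 - q ^ n) * qpoch (- q) q (n - 1)"
  define u v w z where "u = 1 - q ^ (a + k + 1)" and "v = 1 - q ^ (a + k + 2)"
    and "w = 1 + q ^ Suc k" and "z = 1 + q ^ (a + k + 1)"
  have e: "n - Suc k = a + k + 1" "n - k = a + k + 2" "a + Suc k = a + k + 1"
    using n by auto
  have ne: "R \<noteq> 0" "S \<noteq> 0" "u \<noteq> 0" "v \<noteq> 0" "w \<noteq> 0" "z \<noteq> 0"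
    using qpoch_minus_nonzero[OF nz, of "a + k + 2"] qpoch_minus_nonzero[OF nz, of 1]
      nz[rule_format, of "a + k + 1"] nz[rule_format, of "a + k + 2"]
      one_plus_power_nonzero[OF nz, of "Suc k"] one_plus_power_nonzero[OF nz, of "a + k + 1"]
    unfolding R_def S_def u_def v_def w_def z_def by simp_all
  have qn: "qnum q n / qnum q m = (1 - q ^ n) / (1 - q ^ m)" for m
    using nz[rule_format, of 1] by (simp add: qnum_def)
  have p1: "qpoch (- q) q (Suc k) = S * w"
    by (simp add: qpoch_Suc S_def w_def mult.commute)
  have p2: "qpoch (- (q ^ (a + k + 1))) q (Suc k) = z * R"
    by (simp add: qpoch_Suc_shift R_def z_def)
  have c: "qcheb_T_coeff q n (Suc k)
      = Z * q ^ (2 * k + 1) * qbinom q (a + k + 1) (Suc k) / (u * (S * w * (z * R)))"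
    "qcheb_T_coeff q n k = Z * qbinom q (a + k + 2) k / (v * (S * R))"
    unfolding qcheb_T_coeff_def power_Suc_square e qn p1 p2 Z_def u_def v_def
      R_def[symmetric] S_def[symmetric]
    by simp_all
  have "(1 - q ^ (2 * Suc k)) * (1 - q ^ (2 * (a + Suc k))) * qcheb_T_coeff q n (Suc k)
    = (1 - q ^ Suc k) * w * (u * z) * qcheb_T_coeff q n (Suc k)"
    unfolding one_minus_power_double e u_def z_def w_def ..
  also have "\<dots> = Z * q ^ (2 * k + 1) * (1 - q ^ Suc k) * qbinom q (a + k + 1) (Suc k) / (S * R)"
    unfolding c using ne by (simp add: field_simps del: power_Suc)
  also have "\<dots> = Z * q ^ (2 * k + 1) * (qbinom q (a + k + 1) (Suc k) * (v * (1 - q ^ Suc k)))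
      / (v * (S * R))"
    using ne by (simp add: field_simps del: power_Suc)
  also have "\<dots> = q ^ (2 * k + 1) * ((1 - q ^ (a + 2)) * (1 - q ^ (a + 1))) * qcheb_T_coeff q n k"
    unfolding c v_def qbinom_step[OF nz] by (simp only: ac_simps times_divide_eq_right)
  finally show ?thesis .
qed

section \<open>The differential equations\<close>

lemma power_int_pred: "0 < n \<Longrightarrow> q powi (int n - 1) = q ^ (n - 1)"
  by (cases n) (simp_all add: power_int_def nat_add_distrib)

text \<open>The comparison of leading coefficients.  At \<open>n = 0\<close> the exponent \<open>n - 1\<close> is negative, but both
  sides vanish with \<open>[0]\<close>.\<close>

lemma qnum_leading_coefficient:
  fixes q :: "'a::field"
  assumes "q \<noteq> 1"
  shows "(qnum q n)\<^sup>2 = qnum q n * qnum q (n - 1) + q powi (int n - 1) * qnum q n"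
    and "qnum q n * qnum q (n + 2)
      = qnum q n * qnum q (n - 1) + q powi (int n - 1) * qnum q 3 * qnum q n"
proof -
  have "qnum q (Suc m) = qnum q m + q ^ m" "qnum q (Suc m + 2) = qnum q m + q ^ m * qnum q 3" for m
    using assms by (simp_all add: qnum_def field_simps eval_nat_numeral)
  then show "(qnum q n)\<^sup>2 = qnum q n * qnum q (n - 1) + q powi (int n - 1) * qnum q n"
    "qnum q n * qnum q (n + 2)
      = qnum q n * qnum q (n - 1) + q powi (int n - 1) * qnum q 3 * qnum q n"
    by (cases n; simp add: power_int_pred power2_eq_square algebra_simps)+
qed

lemma qcheb_U_differential_equation:
  fixes q s :: "'a::field"
  assumes nz: "\<forall>m>0. q ^ m \<noteq> 1"
  shows "([:0, 1:]\<^sup>2 + [:q * s:]) * qdiff q (qdiff q (qcheb_U n (q\<^sup>2 * s) q))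
           + smult (q powi (int n - 1) * qnum q 3) ([:0, 1:] * qdiff q (qcheb_U n s q))
         = smult (qnum q n * qnum q (n + 2)) (qcheb_U n s q)"
proof -
  have q: "q \<noteq> 1"
    using nz[rule_format, of 1] by simp
  have P: "qcheb_U n t q = (\<Sum>k = 0..n div 2. monom (qcheb_U_coeff q n k * t ^ k) (n - 2 * k))" for t
    by (simp add: qcheb_U_def qcheb_U_coeff_def)
  show ?thesis
    unfolding P
  proof (rule qdiff_equation_of_recurrence[OF q qnum_leading_coefficient(2)[OF q]])
    fix a k
    assume n: "n = a + 2 * Suc k"
    then have "0 < n" by simp
    show "(qnum q n * qnum q (n + 2) - q ^ (2 * Suc k) * (qnum q a * qnum q (a - 1))
          - q powi (int n - 1) * qnum q 3 * qnum q a) * qcheb_U_coeff q n (Suc k)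
      = q ^ (2 * k + 1) * (qnum q (a + 2) * qnum q (a + 1)) * qcheb_U_coeff q n k"
      unfolding power_int_pred[OF \<open>0 < n\<close>] qnum_eigenvalue_U[OF q n] times_divide_eq_left
        qcheb_U_coeff_step[OF nz n]
      by (simp only: qnum_def power2_eq_square times_divide_times_eq
          times_divide_eq_left times_divide_eq_right divide_divide_eq_left)
  qed
qed

lemma qcheb_T_differential_equation:
  fixes q s :: "'a::field"
  assumes nz: "\<forall>m>0. q ^ m \<noteq> 1"
  shows "([:0, 1:]\<^sup>2 + [:q * s:]) * qdiff q (qdiff q (qcheb_T n (q\<^sup>2 * s) q))
           + smult (q powi (int n - 1)) ([:0, 1:] * qdiff q (qcheb_T n s q))
         = smult ((qnum q n)\<^sup>2) (qcheb_T n s q)"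
proof (cases "n = 0")
  case True
  have "qdiff q 1 = 0"
    using nz[rule_format, of 1] qdiff_monom[of q 1 0] by (simp add: monom_0 one_pCons)
  then show ?thesis
    using True nz[rule_format, of 1] by (simp add: qcheb_T_def qdiff_0)
next
  case False
  have q: "q \<noteq> 1"
    using nz[rule_format, of 1] by simp
  have P: "qcheb_T n t q = (\<Sum>k = 0..n div 2. monom (qcheb_T_coeff q n k * t ^ k) (n - 2 * k))" for t
    using False by (simp add: qcheb_T_def qcheb_T_coeff_def)
  show ?thesis
    unfolding P
  proof (rule qdiff_equation_of_recurrence[OF q qnum_leading_coefficient(1)[OF q]])
    fix a k
    assume n: "n = a + 2 * Suc k"
    then have "0 < n" by simp
    show "((qnum q n)\<^sup>2 - q ^ (2 * Suc k) * (qnum q a * qnum q (a - 1))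
          - q powi (int n - 1) * qnum q a) * qcheb_T_coeff q n (Suc k)
      = q ^ (2 * k + 1) * (qnum q (a + 2) * qnum q (a + 1)) * qcheb_T_coeff q n k"
      unfolding power_int_pred[OF \<open>0 < n\<close>] qnum_eigenvalue_T[OF q n] times_divide_eq_left
        qcheb_T_coeff_step[OF nz n]
      by (simp only: qnum_def power2_eq_square times_divide_times_eq
          times_divide_eq_left times_divide_eq_right divide_divide_eq_left)
  qed
qed

text \<open>Specialising both indeterminates of \<open>K[q][s]\<close> to 0 sends \<open>q^m\<close> to 0 and 1 to 1.\<close>

lemma indet_q_power_neq_1:
  assumes "0 < m"
  shows "(indet_q :: 'k::field poly poly fract) ^ m \<noteq> 1"
proof
  assume "(indet_q :: 'k poly poly fract) ^ m = 1"
  moreover have "(indet_q :: 'k poly poly fract) ^ m = Fract ([:[:0, 1:]:] ^ m) 1"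
    by (induction m) (simp_all add: indet_q_def One_fract_def)
  ultimately have "[:[:0, 1 :: 'k:]:] ^ m = 1"
    by (simp add: One_fract_def eq_fract)
  then have "poly (poly ([:[:0, 1 :: 'k:]:] ^ m) 0) 0 = 1"
    by simp
  then show False
    using assms by (simp add: poly_power zero_power)
qed

theorem theorem5p9:
  fixes n :: nat
    and q s :: "'k::field poly poly fract"
    and x :: "'k poly poly fract poly"
  assumes "q = indet_q" and "s = indet_s" and "x = [:0, 1:]"
  shows "(x\<^sup>2 + [:q * s:]) * qdiff q (qdiff q (qcheb_T n (q\<^sup>2 * s) q))
           + smult (q powi (int n - 1)) (x * qdiff q (qcheb_T n s q))
         = smult ((qnum q n)\<^sup>2) (qcheb_T n s q) \<and>
         (x\<^sup>2 + [:q * s:]) * qdiff q (qdiff q (qcheb_U n (q\<^sup>2 * s) q))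
           + smult (q powi (int n - 1) * qnum q 3) (x * qdiff q (qcheb_U n s q))
         = smult (qnum q n * qnum q (n + 2)) (qcheb_U n s q)"
  unfolding assms(3)
  using qcheb_T_differential_equation[of q s n] qcheb_U_differential_equation[of q s n]
    indet_q_power_neq_1 assms(1) by blast

end
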